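(* Let $n\in\mathbb{Z}^+$ and let $f$ be a nondegenerate $n$-ary quadratic form over $R$. Then \[ \delta_v(f)=\sum_{s\in\mathcal{S}}\frac{1}{\nu(R)\,q^{v_s-1}(q+1)}, \] where a term with $v_s=\infty$ is interpreted as $0$.
   Context: $K$ is a local field: a complete discretely valued field of characteristic different from $2$ with valuation $v$, valuation ring $R$, and finite residue field $\mathbb{F}_q$. $\mathcal{S}$ is a set of representatives of the square classes $K^\times/K^{\times 2}$. $\nu(R)\coloneqq[R^\times:R^{\times 2}]$. $D_f\coloneqq f(R^n)\setminus\{0\}$. For $s\in\mathcal{S}$, $v_s\in\mathbb{N}\cup\{\infty\}$ is the minimal valuation $v(x)$ of an element $x\in D_f\cap sK^{\times 2}$, or $\infty$ if there is no such element. $\mu$ is the Haar measure on $R$ with $\mu(R)=1$, and $\delta_v(f)\coloneqq\mu(D_f)$. *)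

theory Defs
  imports "HOL-Analysis.Analysis"
begin

text \<open>
  The value of \<open>v\<close> at \<open>0\<close> (conventionally infinity) is left unspecified, so that \<open>v\<close> can be
  integer-valued. The valuation is normalised, i.e. it maps the nonzero elements onto the integers.
\<close>

locale discrete_valuation =
  fixes v :: "'a::field \<Rightarrow> int"
  assumes v_mult: "\<lbrakk>x \<noteq> 0; y \<noteq> 0\<rbrakk> \<Longrightarrow> v (x * y) = v x + v y"
    and v_add: "\<lbrakk>x \<noteq> 0; y \<noteq> 0; x + y \<noteq> 0\<rbrakk> \<Longrightarrow> min (v x) (v y) \<le> v (x + y)"
    and v_onto: "v ` (UNIV - {0}) = UNIV"

definition val_ring :: "('a::field \<Rightarrow> int) \<Rightarrow> 'a set" where
  "val_ring v = {x. x = 0 \<or> 0 \<le> v x}"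

definition max_ideal :: "('a::field \<Rightarrow> int) \<Rightarrow> 'a set" where
  "max_ideal v = {x. x = 0 \<or> 0 < v x}"

definition val_units :: "('a::field \<Rightarrow> int) \<Rightarrow> 'a set" where
  "val_units v = {x \<in> val_ring v. \<exists>y \<in> val_ring v. x * y = 1}"

definition residue_field :: "('a::field \<Rightarrow> int) \<Rightarrow> 'a set set" where
  "residue_field v = (\<lambda>x. (\<lambda>m. x + m) ` max_ideal v) ` val_ring v"

text \<open>The base \<open>2\<close> is immaterial: any base greater than \<open>1\<close> gives the same uniform structure.\<close>

definition val_dist :: "('a::field \<Rightarrow> int) \<Rightarrow> 'a \<Rightarrow> 'a \<Rightarrow> real" where
  "val_dist v x y = (if x = y then 0 else 2 powi (- v (x - y)))"

locale local_field = discrete_valuation v for v :: "'a::field \<Rightarrow> int" +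
  assumes char_not_2: "(2::'a) \<noteq> 0"
    and complete: "Metric_space.mcomplete (UNIV :: 'a set) (val_dist v)"
    and finite_residue_field: "finite (residue_field v)"

definition residue_card :: "('a::field \<Rightarrow> int) \<Rightarrow> nat" where
  "residue_card v = card (residue_field v)"

text \<open>The index of the subgroup of squares in the unit group, as the number of its cosets.\<close>

definition unit_square_index :: "('a::field \<Rightarrow> int) \<Rightarrow> nat" where
  "unit_square_index v =
     card ((\<lambda>u. (\<lambda>w. u * w\<^sup>2) ` val_units v) ` val_units v)"

definition square_class :: "'a::field \<Rightarrow> 'a set" where
  "square_class s = {s * y\<^sup>2 | y. y \<noteq> 0}"

definition square_class_reps :: "'a::field set \<Rightarrow> bool" where
  "square_class_reps S \<longleftrightarrow> 0 \<notin> S \<and> (\<forall>x. x \<noteq> 0 \<longrightarrow> (\<exists>!s. s \<in> S \<and> x \<in> square_class s))"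

text \<open>
  A quadratic form over the valuation ring is a homogeneous quadratic polynomial with coefficients
  there, viewed as a function on \<open>K\<^sup>n\<close>. The matrix \<open>A\<close> need not be symmetric, so the cross terms may
  have arbitrary (in particular odd) coefficients.
\<close>

definition quadratic_form_over :: "('a::field \<Rightarrow> int) \<Rightarrow> ('a ^ 'n \<Rightarrow> 'a) \<Rightarrow> bool" where
  "quadratic_form_over v f \<longleftrightarrow>
     (\<exists>A :: 'a ^ 'n ^ 'n. (\<forall>i j. A $ i $ j \<in> val_ring v) \<and>
        (\<forall>x. f x = (\<Sum>i\<in>UNIV. \<Sum>j\<in>UNIV. A $ i $ j * x $ i * x $ j)))"

definition polar_form :: "('a::field ^ 'n \<Rightarrow> 'a) \<Rightarrow> 'a ^ 'n \<Rightarrow> 'a ^ 'n \<Rightarrow> 'a" where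
  "polar_form f x y = f (x + y) - f x - f y"

definition nondegenerate_form :: "('a::field ^ 'n \<Rightarrow> 'a) \<Rightarrow> bool" where
  "nondegenerate_form f \<longleftrightarrow> (\<forall>x. (\<forall>y. polar_form f x y = 0) \<longrightarrow> x = 0)"

definition represented :: "('a::field \<Rightarrow> int) \<Rightarrow> ('a ^ 'n \<Rightarrow> 'a) \<Rightarrow> 'a set" where
  "represented v f = f ` {x. \<forall>i. x $ i \<in> val_ring v} - {0}"

text \<open>
  For a form over the valuation ring all represented values have nonnegative valuation, so \<open>nat\<close>
  loses nothing; the infimum of the empty set in \<open>enat\<close> is \<open>\<infinity>\<close>.
\<close>

definition min_val :: "('a::field \<Rightarrow> int) \<Rightarrow> ('a ^ 'n \<Rightarrow> 'a) \<Rightarrow> 'a \<Rightarrow> enat" where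
  "min_val v f s = (INF x \<in> represented v f \<inter> square_class s. enat (nat (v x)))"

text \<open>
  Normalised Haar measure on the additive group of the valuation ring: a translation-invariant
  Borel probability measure. Regularity is automatic, the group being compact and metrizable.
\<close>

definition haar_measure :: "('a::field \<Rightarrow> int) \<Rightarrow> 'a measure \<Rightarrow> bool" where
  "haar_measure v \<mu> \<longleftrightarrow>
     space \<mu> = val_ring v \<and>
     sets \<mu> = sigma_sets (val_ring v)
       {U. openin (subtopology (Metric_space.mtopology UNIV (val_dist v)) (val_ring v)) U} \<and>
     (\<forall>a \<in> val_ring v. \<forall>A \<in> sets \<mu>. emeasure \<mu> ((\<lambda>x. a + x) ` A) = emeasure \<mu> A) \<and>
     emeasure \<mu> (val_ring v) = 1"

definition form_density :: "('a::field \<Rightarrow> int) \<Rightarrow> 'a measure \<Rightarrow> ('a ^ 'n \<Rightarrow> 'a) \<Rightarrow> real" where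
  "form_density v \<mu> f = measure \<mu> (represented v f)"

end

theory Submission
  imports Defs "HOL-Probability.Probability_Measure"
begin

text \<open>
  The values of \<open>f\<close> on integral vectors are stable under multiplication by squares of integral
  elements, so the represented elements of a square class are all \<open>a * y\<^sup>2\<close> with \<open>y\<close> integral and
  nonzero, where \<open>a\<close> is a represented element of minimal valuation \<open>k\<close>. This set is the disjoint
  union over \<open>j\<close> of the cosets of the unit squares \<open>U\<close> by \<open>a * p ^ (2 * j)\<close>, with \<open>p\<close> a uniformiser.
  By Hensel's lemma \<open>U\<close> is a union of finitely many balls of equal radius, hence scaling by an element
  of valuation \<open>m\<close> multiplies its measure by \<open>q ^ (-m)\<close>, and \<open>U\<close> has measure \<open>(1 - 1/q) / \<nu>\<close>.
  The geometric series \<open>(\<Sum>j. q ^ (-k - 2 * j))\<close> then gives the stated summand.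
\<close>

section \<open>Ultrametric balls of a discrete valuation\<close>

context discrete_valuation
begin

text \<open>The disjunct \<open>x = c\<close> stands in for the convention v(0) = infinity, since
  \<open>v 0\<close> is arbitrary here. A larger \<open>m\<close> gives a smaller ball.\<close>

definition vball :: "'a \<Rightarrow> int \<Rightarrow> 'a set" where
  "vball c m = {x. x = c \<or> m \<le> v (x - c)}"

lemma v_one [simp]: "v 1 = 0"
  using v_mult[of 1 1] by simp

lemma v_minus [simp]: "v (- x) = v x"
proof (cases "x = 0")
  case False
  have "v (-1) + v (-1) = 0"
    using v_mult[of "-1" "-1"] by simp
  then have "v (-1) = 0" by simp
  then show ?thesis using v_mult[of "-1" x] False by simp
qed simp

lemma v_minus_commute: "v (x - y) = v (y - x)"
  using v_minus[of "x - y"] by simp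

lemma v_divide: "x \<noteq> 0 \<Longrightarrow> y \<noteq> 0 \<Longrightarrow> v (x / y) = v x - v y"
  using v_mult[of "x / y" y] by simp

lemma v_power: "x \<noteq> 0 \<Longrightarrow> v (x ^ n) = int n * v x"
  by (induction n) (auto simp: v_mult algebra_simps)

lemma exists_v_eq: obtains p where "p \<noteq> 0" "v p = m"
  using v_onto by (metis DiffE UNIV_I imageE singletonI)

lemma in_vball: "x \<in> vball c m \<longleftrightarrow> x = c \<or> m \<le> v (x - c)"
  by (simp add: vball_def)

lemma vball_zero_add:
  assumes "x \<in> vball 0 m" "y \<in> vball 0 m"
  shows "x + y \<in> vball 0 m"
  using assms v_add[of x y] by (cases "x = 0"; cases "y = 0"; cases "x + y = 0") (auto simp: in_vball)

lemma vball_zero_minus: "x \<in> vball 0 m \<Longrightarrow> - x \<in> vball 0 m"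
  by (simp add: in_vball)

lemma in_vball_iff_diff: "x \<in> vball c m \<longleftrightarrow> x - c \<in> vball 0 m"
  by (simp add: in_vball)

lemma vball_zero_mult:
  assumes "x \<in> vball 0 m" "y \<in> vball 0 n"
  shows "x * y \<in> vball 0 (m + n)"
  using assms by (cases "x = 0"; cases "y = 0") (auto simp: in_vball v_mult)

lemma vball_antimono: "m \<le> n \<Longrightarrow> vball c n \<subseteq> vball c m"
  by (auto simp: in_vball)

text \<open>Balls of radius \<open>m\<close> are the cosets of the additive group
  \<open>vball 0 m\<close>, so every point of a ball is a centre of it. Two such balls are therefore
  equal or disjoint.\<close>

lemma vball_eq:
  assumes "d \<in> vball c m"
  shows "vball d m = vball c m"
proof (intro set_eqI iffI)
  fix x
  have *: "d - c \<in> vball 0 m" using assms by (simp add: in_vball_iff_diff[of d])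
  show "x \<in> vball c m" if "x \<in> vball d m"
    using vball_zero_add[OF _ *, of "x - d"] that
    by (simp add: in_vball_iff_diff[of x])
  show "x \<in> vball d m" if "x \<in> vball c m"
    using vball_zero_add[OF _ vball_zero_minus[OF *], of "x - c"] that
    by (simp add: in_vball_iff_diff[of x])
qed

lemma center_in_vball [simp]: "c \<in> vball c m"
  by (simp add: in_vball)

lemma vball_eqI: "x \<in> vball c m \<Longrightarrow> x \<in> vball d m \<Longrightarrow> vball c m = vball d m"
  using vball_eq by metis

lemma val_ring_eq_vball: "val_ring v = vball 0 0"
  by (auto simp: val_ring_def in_vball)

lemma max_ideal_eq_vball: "max_ideal v = vball 0 1"
  by (auto simp: max_ideal_def in_vball)

lemma vball_subset_val_ring:
  assumes "c \<in> val_ring v" "0 \<le> m"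
  shows "vball c m \<subseteq> val_ring v"
  using assms vball_eq[of c 0 0] vball_antimono[of 0 m c] by (simp add: val_ring_eq_vball)

lemma val_ring_add: "x \<in> val_ring v \<Longrightarrow> y \<in> val_ring v \<Longrightarrow> x + y \<in> val_ring v"
  unfolding val_ring_eq_vball by (rule vball_zero_add)

lemma val_ring_mult: "x \<in> val_ring v \<Longrightarrow> y \<in> val_ring v \<Longrightarrow> x * y \<in> val_ring v"
  unfolding val_ring_eq_vball using vball_zero_mult[of x 0 y 0] by simp

lemma val_ring_sum: "(\<And>i. i \<in> I \<Longrightarrow> g i \<in> val_ring v) \<Longrightarrow> sum g I \<in> val_ring v"
proof (induction I rule: infinite_finite_induct)
  case (insert x F)
  then show ?case by (simp add: val_ring_add)
qed (auto simp: val_ring_def)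

lemma vball_translate: "(\<lambda>x. a + x) ` vball c m = vball (a + c) m"
proof (intro set_eqI iffI)
  fix x assume "x \<in> vball (a + c) m"
  then have "x - a \<in> vball c m" by (auto simp: in_vball algebra_simps)
  then show "x \<in> (\<lambda>x. a + x) ` vball c m" by (auto intro: image_eqI[of _ _ "x - a"])
qed (auto simp: in_vball)

lemma vball_scale:
  assumes "a \<noteq> 0"
  shows "(\<lambda>x. a * x) ` vball c m = vball (a * c) (v a + m)"
proof -
  have *: "a * x \<in> vball (a * c) (v a + m) \<longleftrightarrow> x \<in> vball c m" for x
    using assms by (cases "x = c") (auto simp: in_vball v_mult simp flip: right_diff_distrib)
  show ?thesis
  proof (intro set_eqI iffI)
    fix x assume "x \<in> vball (a * c) (v a + m)"
    then have "x / a \<in> vball c m" using *[of "x / a"] assms by simp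
    then show "x \<in> (\<lambda>x. a * x) ` vball c m" using assms by (auto intro: image_eqI[of _ _ "x / a"])
  qed (use * in auto)
qed

text \<open>Residue classes become balls of radius 1, so that counting them and measuring them
  reduces to facts about balls.\<close>

lemma residue_field_eq: "residue_field v = (\<lambda>x. vball x 1) ` val_ring v"
  by (simp add: residue_field_def max_ideal_eq_vball vball_translate)

lemma val_units_eq: "val_units v = {x. x \<noteq> 0 \<and> v x = 0}"
proof (intro set_eqI iffI)
  fix x assume "x \<in> val_units v"
  then obtain y where "x \<in> val_ring v" "y \<in> val_ring v" "x * y = 1"
    by (auto simp: val_units_def)
  moreover from this have "x \<noteq> 0" "y \<noteq> 0" by auto
  ultimately show "x \<in> {x. x \<noteq> 0 \<and> v x = 0}"
    using v_mult[of x y] by (auto simp: val_ring_def)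
next
  fix x assume "x \<in> {x. x \<noteq> 0 \<and> v x = 0}"
  then have "x \<in> val_ring v" "1 / x \<in> val_ring v" "x * (1 / x) = 1"
    by (auto simp: val_ring_def v_divide)
  then show "x \<in> val_units v" unfolding val_units_def by blast
qed

lemma val_ring_minus_max_ideal: "val_ring v - max_ideal v = val_units v"
  by (auto simp: val_ring_def max_ideal_def val_units_eq)

sublocale metric: Metric_space UNIV "val_dist v"
proof
  fix x y z :: 'a
  show "0 \<le> val_dist v x y" "val_dist v x y = val_dist v y x" "val_dist v x y = 0 \<longleftrightarrow> x = y"
    by (auto simp: val_dist_def v_minus_commute[of x y])
  show "val_dist v x z \<le> val_dist v x y + val_dist v y z"
  proof (cases "x = y \<or> y = z \<or> x = z")
    case False
    then have "min (v (x - y)) (v (y - z)) \<le> v (x - z)"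
      using v_add[of "x - y" "y - z"] by simp
    \<comment> \<open>Stronger than the triangle inequality: one of the two distances on the right
      already dominates, and the other is nonnegative.\<close>
    then have "2 powi (- v (x - z)) \<le> (2::real) powi (- v (x - y)) \<or>
        2 powi (- v (x - z)) \<le> (2::real) powi (- v (y - z))"
      by (auto simp: min_def power_int_increasing split: if_splits)
    moreover have "0 \<le> (2::real) powi i" for i by simp
    ultimately show ?thesis
      using False by (auto simp: val_dist_def intro: add_increasing add_increasing2)
  qed (auto simp: val_dist_def)
qed

text \<open>Nonzero distances are integral powers of 2, so being below 2 to the \<open>1 - m\<close>
  is the same as being at most 2 to the \<open>- m\<close>. This makes valuation balls open in the
  metric topology.\<close>

lemma vball_eq_mball: "vball c m = metric.mball c (2 powi (1 - m))"
proof -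
  have "(2::real) powi (- v (c - x)) < 2 powi (1 - m) \<longleftrightarrow> m \<le> v (x - c)" for x
    using power_int_strict_increasing[of "- v (c - x)" "1 - m" "2::real"]
      power_int_increasing[of "1 - m" "- v (c - x)" "2::real"] v_minus_commute[of c x]
    by (cases "m \<le> v (x - c)") auto
  then show ?thesis by (auto simp: in_vball metric.in_mball val_dist_def split: if_splits)
qed

lemma openin_vball: "openin metric.mtopology (vball c m)"
  by (simp add: vball_eq_mball)

end


section \<open>Hensel's lemma for squares\<close>

context local_field
begin

lemma v_two_nonneg: "0 \<le> v 2"
  using v_add[of 1 1] char_not_2 by simp

text \<open>The ball of this radius about 1 is 1 + 4M with M the maximal ideal, because
  \<open>v 4 = 2 * v 2\<close>. The residue characteristic may be 2.\<close>

definition square_radius :: int where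
  "square_radius = 2 * v 2 + 1"

lemma square_radius_nonneg: "0 \<le> square_radius"
  using v_two_nonneg by (simp add: square_radius_def)

lemma vball_one_subset_units: "vball 1 1 \<subseteq> val_units v"
proof
  fix y assume y: "y \<in> vball 1 1"
  have "1 \<in> val_ring v" by (simp add: val_ring_def)
  then have "y \<in> val_ring v" using vball_subset_val_ring[of 1 1] y by auto
  moreover have "y \<notin> max_ideal v"
  proof
    assume "y \<in> max_ideal v"
    then have "vball 1 1 = vball 0 1"
      using vball_eqI[OF y] by (simp add: max_ideal_eq_vball)
    then have "(1::'a) \<in> vball 0 1" using center_in_vball by metis
    then show False by (simp add: in_vball)
  qed
  ultimately show "y \<in> val_units v" using val_ring_minus_max_ideal by auto
qed

text \<open>
  Substituting \<open>y = 1 + 2 * w\<close> and \<open>x = 1 + 4 * z\<close> turns \<open>y\<^sup>2 = x\<close> into the fixed point equation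
  \<open>w = z - w\<^sup>2\<close>, whose right-hand side is a contraction of the maximal ideal. Composing it with the
  1-Lipschitz retraction \<open>h\<close> onto the ideal makes it a contraction of the whole field.
\<close>

lemma vball_one_subset_squares:
  assumes "x \<in> vball 1 square_radius"
  obtains y where "y \<in> val_units v" "y\<^sup>2 = x"
proof -
  define z where "z = (x - 1) / 4"
  define h where "h w = (if w \<in> vball 0 1 then w else 0)" for w :: 'a
  define g where "g w = z - (h w)\<^sup>2" for w
  have four: "(4::'a) = 2 * 2" by simp
  have four_nz: "(4::'a) \<noteq> 0" unfolding four using char_not_2 by (simp only: mult_eq_0_iff) simp
  have v4: "v 4 = 2 * v 2" unfolding four using v_mult[of 2 2] char_not_2 by simp
  have z: "z \<in> vball 0 1"
    using assms four_nz by (cases "x = 1") (auto simp: z_def in_vball square_radius_def v_divide v4)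
  have h: "h w \<in> vball 0 1" for w by (simp add: h_def)
  have gball: "g w \<in> vball 0 1" for w
  proof -
    have "(h w)\<^sup>2 \<in> vball 0 1"
      using vball_zero_mult[OF h h, of w w] vball_antimono[of 1 2 0]
      by (auto simp: power2_eq_square)
    then show ?thesis
      using vball_zero_add[OF z vball_zero_minus] by (simp add: g_def)
  qed
  have h_lip: "v (a - b) \<le> v (h a - h b)" if "h a \<noteq> h b" for a b
  proof -
    \<comment> \<open>If exactly one argument lies in the ideal, the arguments are at valuation at
      most 0 from each other, while their images under \<open>h\<close> both lie in the
      ideal.\<close>
    have out: "v (a - b) \<le> 0" if "a \<in> vball 0 1" "b \<notin> vball 0 1" for a b
    proof (rule ccontr)
      assume "\<not> v (a - b) \<le> 0"
      then have "a - b \<in> vball 0 1" by (auto simp: in_vball)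
      then show False
        using vball_zero_add[OF that(1) vball_zero_minus, of "a - b"] that(2) by simp
    qed
    show ?thesis
      using that out[of a b] out[of b a] v_minus_commute[of a b]
      by (auto simp: h_def in_vball split: if_splits)
  qed
  have contr: "val_dist v (g a) (g b) \<le> 1/2 * val_dist v a b" for a b
  proof (cases "g a = g b")
    case True
    then show ?thesis by (simp add: val_dist_def)
  next
    case False
    have eq: "g a - g b = (h b - h a) * (h b + h a)"
      by (simp add: g_def power2_eq_square algebra_simps)
    with False have nz: "h b - h a \<noteq> 0" "h b + h a \<noteq> 0" by auto
    then have "a \<noteq> b" by auto
    \<comment> \<open>The second factor lies in the maximal ideal and raises the valuation by at
      least one, which in base 2 halves the distance.\<close>
    have "1 \<le> v (h b + h a)" using vball_zero_add[OF h h, of b a] nz by (simp add: in_vball)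
    then have "v (a - b) + 1 \<le> v (g a - g b)"
      using h_lip[of b a] nz v_minus_commute[of a b] by (simp add: eq v_mult)
    then have "(2::real) powi (- v (g a - g b)) \<le> 2 powi (- v (a - b) - 1)"
      by (intro power_int_increasing) auto
    also have "\<dots> = 1/2 * 2 powi (- v (a - b))" by (simp add: power_int_diff)
    finally show ?thesis using False \<open>a \<noteq> b\<close> by (simp add: val_dist_def)
  qed
  obtain w where "g w = w"
    using metric.Banach_fixedpoint_thm[OF complete, of g "1/2"] contr by auto
  \<comment> \<open>Being a value of \<open>g\<close>, the fixed point lies in the ideal, where
    \<open>h\<close> is the identity.\<close>
  then have w: "w \<in> vball 0 1" "w + w\<^sup>2 = z"
    using gball[of w] by (auto simp: g_def h_def algebra_simps)
  have "2 * w \<in> vball 0 1"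
    using vball_zero_mult[of 2 0 w 1] v_two_nonneg w by (simp add: in_vball)
  then have "1 + 2 * w \<in> val_units v"
    using vball_one_subset_units by (auto simp: in_vball)
  moreover have "(1 + 2 * w)\<^sup>2 = x"
  proof -
    have "(1 + 2 * w)\<^sup>2 = 1 + 4 * (w + w\<^sup>2)" by (simp add: power2_eq_square algebra_simps)
    also have "4 * (w + w\<^sup>2) = x - 1" using w(2) four_nz by (simp only: z_def) simp
    finally show ?thesis by simp
  qed
  ultimately show thesis using that by blast
qed

section \<open>Unit squares and their cosets\<close>

definition unit_squares :: "'a set" where
  "unit_squares = (\<lambda>w. w\<^sup>2) ` val_units v"

text \<open>The factor need not be a unit: cosets of elements of positive valuation are the pieces
  into which a represented square class is cut later.\<close>

definition square_coset :: "'a \<Rightarrow> 'a set" where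
  "square_coset a = (\<lambda>x. a * x) ` unit_squares"

lemma unit_squares_subset: "unit_squares \<subseteq> val_units v"
  by (auto simp: unit_squares_def val_units_eq v_power)

lemma in_square_coset: "x \<in> square_coset a \<longleftrightarrow> (\<exists>w. w \<in> val_units v \<and> x = a * w\<^sup>2)"
  by (auto simp: square_coset_def unit_squares_def)

lemma center_in_square_coset: "a \<in> square_coset a"
  unfolding in_square_coset by (rule exI[of _ 1]) (simp add: val_units_eq)

lemma square_coset_eq:
  assumes "b \<in> square_coset a"
  shows "square_coset b = square_coset a"
proof -
  obtain w where w: "w \<in> val_units v" "b = a * w\<^sup>2" using assms by (auto simp: in_square_coset)
  show ?thesis
  proof (intro set_eqI iffI)
    fix x assume "x \<in> square_coset b"
    then obtain u where "u \<in> val_units v" "x = b * u\<^sup>2" by (auto simp: in_square_coset)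
    then show "x \<in> square_coset a"
      unfolding in_square_coset using w
      by (intro exI[of _ "w * u"]) (auto simp: val_units_eq v_mult power_mult_distrib)
  next
    fix x assume "x \<in> square_coset a"
    then obtain u where "u \<in> val_units v" "x = a * u\<^sup>2" by (auto simp: in_square_coset)
    then show "x \<in> square_coset b"
      unfolding in_square_coset using w
      by (intro exI[of _ "u / w"]) (auto simp: val_units_eq v_divide power_divide)
  qed
qed

lemma unit_square_index_eq: "unit_square_index v = card (square_coset ` val_units v)"
  by (simp add: unit_square_index_def square_coset_def unit_squares_def image_image)

text \<open>Multiplication by the unit \<open>u\<close> carries the ball about 1, which consists of
  squares by Hensel's lemma, to the ball of the same radius about \<open>u\<close>.\<close>

lemma vball_subset_unit_squares:
  assumes "u \<in> unit_squares"
  shows "vball u square_radius \<subseteq> unit_squares"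
proof
  fix x assume x: "x \<in> vball u square_radius"
  obtain w where w: "w \<in> val_units v" "u = w\<^sup>2" using assms by (auto simp: unit_squares_def)
  then have u: "u \<noteq> 0" "v u = 0" by (auto simp: val_units_eq v_power)
  have "x \<in> (\<lambda>x. u * x) ` vball 1 square_radius"
    using vball_scale[of u 1 square_radius] u x by simp
  then obtain y where y: "y \<in> vball 1 square_radius" "x = u * y" by blast
  then obtain t where "t \<in> val_units v" "t\<^sup>2 = y" using vball_one_subset_squares by blast
  then have "x = (w * t)\<^sup>2" "w * t \<in> val_units v"
    using y w by (auto simp: power_mult_distrib val_units_eq v_mult)
  then show "x \<in> unit_squares" by (auto simp: unit_squares_def)
qed

lemma vball_subset_square_coset:
  assumes "a \<in> val_units v"
  shows "vball a square_radius \<subseteq> square_coset a"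
proof -
  have a: "a \<noteq> 0" "v a = 0" using assms by (auto simp: val_units_eq)
  have "1 \<in> unit_squares" by (auto simp: unit_squares_def val_units_eq intro!: image_eqI[of _ _ 1])
  from image_mono[OF vball_subset_unit_squares[OF this], of "\<lambda>x. a * x"] show ?thesis
    using a vball_scale[OF a(1), of 1 square_radius] by (simp add: square_coset_def)
qed

section \<open>Finiteness of balls, unit square cosets and square classes\<close>

lemma exists_finite_vball_cover:
  "\<exists>T. finite T \<and> T \<subseteq> val_ring v \<and> val_ring v \<subseteq> (\<Union>t\<in>T. vball t (int n))"
proof (induction n)
  case 0
  show ?case by (rule exI[of _ "{0}"]) (simp add: val_ring_eq_vball)
next
  case (Suc n)
  then obtain T where T: "finite T" "T \<subseteq> val_ring v" "val_ring v \<subseteq> (\<Union>t\<in>T. vball t (int n))"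
    by blast
  obtain X where X: "finite X" "X \<subseteq> val_ring v" "residue_field v = (\<lambda>x. vball x 1) ` X"
    using finite_subset_image[OF finite_residue_field, of "\<lambda>x. vball x 1" "val_ring v"]
    by (auto simp: residue_field_eq)
  obtain p where p: "p \<noteq> 0" "v p = int n" by (rule exists_v_eq)
  \<comment> \<open>A point of the ball about \<open>t\<close> is \<open>t + p * z\<close> with
    \<open>z\<close> integral, and \<open>z\<close> is congruent to some residue representative
    \<open>x\<close> modulo the maximal ideal.\<close>
  define T' where "T' = (\<lambda>(t, x). t + p * x) ` (T \<times> X)"
  have "finite T'" using T X by (simp add: T'_def)
  moreover have "p \<in> val_ring v" using p by (simp add: val_ring_def)
  then have "T' \<subseteq> val_ring v" using T X by (auto simp: T'_def intro!: val_ring_add val_ring_mult)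
  moreover have "val_ring v \<subseteq> (\<Union>t\<in>T'. vball t (int (Suc n)))"
  proof
    fix y assume "y \<in> val_ring v"
    then obtain t where t: "t \<in> T" "y \<in> vball t (int n)" using T by blast
    then have "(y - t) / p \<in> val_ring v"
      using p by (cases "y = t") (auto simp: in_vball val_ring_def v_divide)
    then have "vball ((y - t) / p) 1 \<in> residue_field v" by (auto simp: residue_field_eq)
    then obtain x where x: "x \<in> X" "vball ((y - t) / p) 1 = vball x 1" using X by auto
    then have "(y - t) / p \<in> vball x 1" using center_in_vball by metis
    then have "y - t \<in> (\<lambda>x. p * x) ` vball x 1"
      using p by (intro image_eqI[of _ _ "(y - t) / p"]) auto
    then have "y - t \<in> vball (p * x) (int n + 1)" using vball_scale[OF p(1), of x 1] p by simp
    then have "y \<in> vball (t + p * x) (int (Suc n))" by (auto simp: in_vball algebra_simps)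
    then show "y \<in> (\<Union>t\<in>T'. vball t (int (Suc n)))" using t x by (auto simp: T'_def)
  qed
  ultimately show ?case by blast
qed

lemma finite_vballs:
  assumes "A \<subseteq> val_ring v" "0 \<le> m"
  shows "finite ((\<lambda>x. vball x m) ` A)"
proof -
  obtain T where T: "finite T" "val_ring v \<subseteq> (\<Union>t\<in>T. vball t m)"
    using exists_finite_vball_cover[of "nat m"] assms by auto
  have "(\<lambda>x. vball x m) ` A \<subseteq> (\<lambda>x. vball x m) ` T"
  proof clarify
    fix x assume "x \<in> A"
    then obtain t where "t \<in> T" "x \<in> vball t m" using T assms by blast
    then show "vball x m \<in> (\<lambda>x. vball x m) ` T" using vball_eq[of x t m] by simp
  qed
  then show ?thesis using T(1) by (meson finite_imageI finite_subset)
qed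

text \<open>The coset of a unit depends only on the ball of radius \<open>square_radius\<close>
  around it, and there are finitely many such balls. Hence the \<open>card\<close> in
  \<open>unit_square_index\<close> is a true index and not the default 0 of an infinite set.\<close>

lemma finite_square_cosets: "finite (square_coset ` val_units v)"
proof -
  \<comment> \<open>All points of such a ball have the same coset, so the union of their cosets
    recovers it without choosing a centre.\<close>
  have "square_coset ` val_units v \<subseteq>
      (\<lambda>B. \<Union>(square_coset ` B)) ` (\<lambda>x. vball x square_radius) ` val_units v"
  proof clarify
    fix u assume u: "u \<in> val_units v"
    then have "square_coset x = square_coset u" if "x \<in> vball u square_radius" for x
      using vball_subset_square_coset square_coset_eq that by blast
    then have "square_coset u = \<Union>(square_coset ` vball u square_radius)"
      using center_in_vball by blast
    then show "square_coset u \<in>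
        (\<lambda>B. \<Union>(square_coset ` B)) ` (\<lambda>x. vball x square_radius) ` val_units v"
      using u by blast
  qed
  moreover have "finite ((\<lambda>x. vball x square_radius) ` val_units v)"
    by (rule finite_vballs[OF _ square_radius_nonneg]) (auto simp: val_units_def)
  ultimately show ?thesis by (meson finite_imageI finite_subset)
qed

text \<open>A square class is determined by the parity of the valuation and the unit part modulo
  unit squares. Finiteness is what allows additivity over \<open>S\<close> and a meaningful
  \<open>sum\<close>.\<close>

lemma finite_square_class_reps:
  fixes S :: "'a set"
  assumes "square_class_reps S"
  shows "finite S"
proof -
  obtain p where p: "p \<noteq> 0" "v p = 1" by (rule exists_v_eq)
  have vp: "v (p powi k) = k" for k
  proof (cases "0 \<le> k")
    case True
    then show ?thesis using p by (simp add: power_int_def v_power)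
  next
    case False
    then show ?thesis using p v_divide[of 1 "p ^ nat (- k)"]
      by (simp add: power_int_def v_power inverse_eq_divide power_one_over)
  qed
  define F where "F s = (v s mod 2, square_coset (s / p powi v s))" for s
  have S0: "s \<noteq> 0" if "s \<in> S" for s using assms that by (auto simp: square_class_reps_def)
  have self: "s \<in> square_class s" for s :: 'a
    unfolding square_class_def by (auto intro!: exI[of _ 1])
  have "inj_on F S"
  proof (rule inj_onI)
    fix s t assume st: "s \<in> S" "t \<in> S" "F s = F t"
    then have "s / p powi v s \<in> square_coset (t / p powi v t)"
      using center_in_square_coset by (metis F_def prod.inject)
    then obtain w where w: "w \<in> val_units v" "s / p powi v s = t / p powi v t * w\<^sup>2"
      by (auto simp: in_square_coset)
    \<comment> \<open>Equal parities make the quotient of the two powers of \<open>p\<close> a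
      square, so \<open>s\<close> and \<open>t\<close> differ by a square altogether.\<close>
    have "even (v s - v t)" using st(3) by (auto simp: F_def mod_eq_dvd_iff)
    then obtain k where k: "v s = v t + 2 * k" by (metis add.commute diff_add_cancel dvdE)
    have "p powi v s = p powi v t * (p powi k)\<^sup>2"
      using p power_int_add[of p "v t" "k + k"] power_int_add[of p k k]
      by (simp add: k power2_eq_square)
    moreover have "s = t / p powi v t * w\<^sup>2 * p powi v s" using w(2) p by (simp add: divide_eq_eq)
    ultimately have "s = t * (w * p powi k)\<^sup>2" using p by (simp add: power_mult_distrib)
    moreover have "w * p powi k \<noteq> 0" using w p by (auto simp: val_units_eq)
    ultimately have "s \<in> square_class t" unfolding square_class_def by blast
    then show "s = t" using assms st self[of s] S0[of s] unfolding square_class_reps_def by blast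
  qed
  moreover have "F ` S \<subseteq> {0, 1} \<times> square_coset ` val_units v"
    using p S0 vp by (auto simp: F_def val_units_eq v_divide)
  ultimately show ?thesis
    by (meson finite_SigmaI finite_imageD finite_insert finite.emptyI finite_square_cosets
        finite_subset)
qed

text \<open>The elements 0 and 1 lie in different residue classes.\<close>

lemma residue_card_gt_1: "1 < residue_card v"
proof -
  have "vball 0 1 \<noteq> vball 1 1"
  proof
    assume "vball 0 1 = vball 1 1"
    then have "(1::'a) \<in> vball 0 1" using center_in_vball by metis
    then show False by (simp add: in_vball)
  qed
  moreover have "{vball 0 1, vball 1 1} \<subseteq> residue_field v"
    by (auto simp: residue_field_eq val_ring_def)
  ultimately show ?thesis
    using card_mono[OF finite_residue_field, of "{vball 0 1, vball 1 1}"]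
    by (simp add: residue_card_def)
qed

end

text \<open>Allows a representative of a class to be replaced by a represented element of minimal
  valuation.\<close>

lemma square_class_eq:
  assumes "x \<in> square_class s"
  shows "square_class x = square_class s"
proof -
  obtain y where y: "y \<noteq> 0" "x = s * y\<^sup>2" using assms by (auto simp: square_class_def)
  show ?thesis
  proof (intro set_eqI iffI)
    fix z assume "z \<in> square_class x"
    then obtain t where "t \<noteq> 0" "z = x * t\<^sup>2" by (auto simp: square_class_def)
    then have "z = s * (y * t)\<^sup>2" "y * t \<noteq> 0" using y by (auto simp: power_mult_distrib)
    then show "z \<in> square_class s" unfolding square_class_def by blast
  next
    fix z assume "z \<in> square_class s"
    then obtain t where "t \<noteq> 0" "z = s * t\<^sup>2" by (auto simp: square_class_def)
    then have "z = x * (t / y)\<^sup>2" "t / y \<noteq> 0" using y by (auto simp: power_divide)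
    then show "z \<in> square_class x" unfolding square_class_def by blast
  qed
qed

section \<open>Haar measure of balls and of scaled sets\<close>

locale haar_local_field = local_field v for v :: "'a::field \<Rightarrow> int" +
  fixes \<mu> :: "'a measure"
  assumes haar: "haar_measure v \<mu>"
begin

lemma space_haar: "space \<mu> = val_ring v"
  using haar by (simp add: haar_measure_def)

sublocale prob_space \<mu>
  using haar by (intro prob_spaceI) (simp add: haar_measure_def)

lemma vball_in_sets:
  assumes "c \<in> val_ring v" "0 \<le> m"
  shows "vball c m \<in> sets \<mu>"
proof -
  have "openin (subtopology metric.mtopology (val_ring v)) (vball c m)"
    using openin_vball[of c m] vball_subset_val_ring[OF assms]
    by (auto simp: openin_subtopology)
  then show ?thesis using haar by (auto simp: haar_measure_def)
qed

lemma measure_vball_center: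
  assumes "c \<in> val_ring v" "0 \<le> m"
  shows "prob (vball c m) = prob (vball 0 m)"
proof -
  have "vball 0 m \<in> sets \<mu>" using assms by (intro vball_in_sets) (auto simp: val_ring_def)
  then have "emeasure \<mu> ((\<lambda>x. c + x) ` vball 0 m) = emeasure \<mu> (vball 0 m)"
    using haar assms by (auto simp: haar_measure_def)
  then show ?thesis by (simp add: vball_translate measure_def)
qed

text \<open>Only translation invariance is given, so the factor is found by counting: scaling by
  \<open>p\<close> of valuation \<open>n\<close> sends the residue classes to disjoint translates of
  the next smaller ball, which together fill \<open>vball 0 (int n)\<close>.\<close>

lemma measure_vball:
  assumes "c \<in> val_ring v"
  shows "prob (vball c (int n)) = 1 / real (residue_card v) ^ n"
proof -
  have "prob (vball 0 (int n)) = 1 / real (residue_card v) ^ n"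
  proof (induction n)
    case 0
    show ?case using prob_space by (simp add: space_haar val_ring_eq_vball)
  next
    case (Suc n)
    obtain p where p: "p \<noteq> 0" "v p = int n" by (rule exists_v_eq)
    have piece: "(\<lambda>x. p * x) ` vball x 1 = vball (p * x) (int (Suc n))" for x
      using vball_scale[OF p(1), of x 1] p by (simp add: add.commute)
    have px: "p * x \<in> val_ring v" if "x \<in> val_ring v" for x
      using that p by (intro val_ring_mult) (auto simp: val_ring_def)
    have "vball 0 (int n) = (\<lambda>x. p * x) ` \<Union>(residue_field v)"
    proof -
      have "\<Union>(residue_field v) = val_ring v"
        using vball_subset_val_ring[of _ 1] by (auto simp: residue_field_eq)
      then show ?thesis using vball_scale[OF p(1), of 0 0] p by (simp add: val_ring_eq_vball)
    qed
    also have "\<dots> = (\<Union>C\<in>residue_field v. (\<lambda>x. p * x) ` C)" by blast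
    also have "prob \<dots> = (\<Sum>C\<in>residue_field v. prob ((\<lambda>x. p * x) ` C))"
    proof (rule finite_measure_finite_Union[OF finite_residue_field])
      show "(\<lambda>C. (\<lambda>x. p * x) ` C) ` residue_field v \<subseteq> sets \<mu>"
        using px piece by (auto simp: residue_field_eq intro!: vball_in_sets)
      show "disjoint_family_on (\<lambda>C. (\<lambda>x. p * x) ` C) (residue_field v)"
        unfolding disjoint_family_on_def
      proof (intro ballI impI)
        fix C D assume "C \<in> residue_field v" "D \<in> residue_field v" "C \<noteq> D"
        then have "C \<inter> D = {}" using vball_eqI unfolding residue_field_eq by blast
        then show "(\<lambda>x. p * x) ` C \<inter> (\<lambda>x. p * x) ` D = {}" using p(1) by auto
      qed
    qed
    also have "\<dots> = (\<Sum>C\<in>residue_field v. prob (vball 0 (int (Suc n))))"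
    proof (rule sum.cong)
      fix C assume "C \<in> residue_field v"
      then obtain x where "x \<in> val_ring v" "C = vball x 1" by (auto simp: residue_field_eq)
      then show "prob ((\<lambda>x. p * x) ` C) = prob (vball 0 (int (Suc n)))"
        using piece[of x] measure_vball_center[OF px] by simp
    qed simp
    finally show ?case
      using Suc residue_card_gt_1 by (simp add: residue_card_def field_simps)
  qed
  then show ?thesis using measure_vball_center[OF assms] by simp
qed

text \<open>A set that contains a ball of one fixed radius around each of its points is a finite
  disjoint union of balls, and scaling acts on each ball in a known way.\<close>

lemma sets_measure_scale:
  assumes A: "A \<subseteq> val_ring v" and m: "0 \<le> m" and balls: "\<And>x. x \<in> A \<Longrightarrow> vball x m \<subseteq> A"
    and a: "a \<in> val_ring v" "a \<noteq> 0"
  shows "(\<lambda>x. a * x) ` A \<in> sets \<mu>"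
    and "prob ((\<lambda>x. a * x) ` A) = prob A / real (residue_card v) ^ nat (v a)"
proof -
  define P where "P = (\<lambda>x. vball x m) ` A"
  have finP: "finite P" unfolding P_def by (rule finite_vballs[OF A m])
  have UP: "\<Union>P = A" using balls by (auto simp: P_def)
  have va: "0 \<le> v a" using a by (simp add: val_ring_def)
  have piece: "(\<lambda>x. b * x) ` C \<in> sets \<mu> \<and>
      prob ((\<lambda>x. b * x) ` C) = 1 / real (residue_card v) ^ nat (v b + m)"
    if C: "C \<in> P" and b: "b \<in> val_ring v" "b \<noteq> 0" for b C
  proof -
    obtain x where x: "x \<in> val_ring v" "C = vball x m" using C A by (auto simp: P_def)
    have "0 \<le> v b" using b by (simp add: val_ring_def)
    then show ?thesis
      using vball_in_sets[of "b * x" "v b + m"] measure_vball[of "b * x" "nat (v b + m)"]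
        vball_scale[OF b(2), of x m] x b m by (auto intro: val_ring_mult)
  qed
  \<comment> \<open>Kept general in \<open>b\<close>: the instances \<open>b = 1\<close> and
    \<open>b = a\<close> share the count \<open>card P\<close>, and comparing them gives the scaling
    factor.\<close>
  have main: "(\<lambda>x. b * x) ` A \<in> sets \<mu> \<and>
      prob ((\<lambda>x. b * x) ` A) = real (card P) / real (residue_card v) ^ nat (v b + m)"
    if b: "b \<in> val_ring v" "b \<noteq> 0" for b
  proof
    have eq: "(\<lambda>x. b * x) ` A = (\<Union>C\<in>P. (\<lambda>x. b * x) ` C)" unfolding UP[symmetric] by blast
    show "(\<lambda>x. b * x) ` A \<in> sets \<mu>"
      unfolding eq using finP piece[OF _ b] by (intro sets.finite_UN) auto
    have "prob ((\<lambda>x. b * x) ` A) = (\<Sum>C\<in>P. prob ((\<lambda>x. b * x) ` C))"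
      unfolding eq
    proof (rule finite_measure_finite_Union[OF finP])
      show "(\<lambda>C. (\<lambda>x. b * x) ` C) ` P \<subseteq> sets \<mu>" using piece[OF _ b] by auto
      show "disjoint_family_on (\<lambda>C. (\<lambda>x. b * x) ` C) P"
        unfolding disjoint_family_on_def
      proof (intro ballI impI)
        fix C D assume "C \<in> P" "D \<in> P" "C \<noteq> D"
        then have "C \<inter> D = {}" using vball_eqI unfolding P_def by blast
        then show "(\<lambda>x. b * x) ` C \<inter> (\<lambda>x. b * x) ` D = {}" using b(2) by auto
      qed
    qed
    then show "prob ((\<lambda>x. b * x) ` A) = real (card P) / real (residue_card v) ^ nat (v b + m)"
      using piece[OF _ b] by simp
  qed
  show "(\<lambda>x. a * x) ` A \<in> sets \<mu>" using main[OF a] by blast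
  have "prob A = real (card P) / real (residue_card v) ^ nat m"
    using main[of 1] by (simp add: val_ring_def)
  then show "prob ((\<lambda>x. a * x) ` A) = prob A / real (residue_card v) ^ nat (v a)"
    using main[OF a] va m by (simp add: nat_add_distrib power_add field_simps)
qed

section \<open>Measure of unit squares and of integral square multiples\<close>

lemma
  assumes "a \<in> val_ring v" "a \<noteq> 0"
  shows square_coset_in_sets: "square_coset a \<in> sets \<mu>"
    and measure_square_coset:
      "prob (square_coset a) = prob unit_squares / real (residue_card v) ^ nat (v a)"
proof -
  have "unit_squares \<subseteq> val_ring v" using unit_squares_subset by (auto simp: val_units_def)
  note scale = sets_measure_scale[OF this square_radius_nonneg vball_subset_unit_squares assms]
  show "square_coset a \<in> sets \<mu>"
    and "prob (square_coset a) = prob unit_squares / real (residue_card v) ^ nat (v a)"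
    using scale by (simp_all add: square_coset_def)
qed

lemma measure_units: "prob (val_units v) = 1 - 1 / real (residue_card v)"
proof -
  have "vball 0 1 \<in> sets \<mu>" by (rule vball_in_sets) (auto simp: val_ring_def)
  then have "prob (val_ring v - vball 0 1) = 1 - prob (vball 0 1)"
    using prob_compl[of "vball 0 1"] by (simp add: space_haar)
  then show ?thesis
    using measure_vball[of 0 1] val_ring_minus_max_ideal
    by (simp add: max_ideal_eq_vball val_ring_def)
qed

text \<open>The cosets of the unit squares partition the unit group, and all have the same measure
  because scaling by an element of valuation 0 preserves it.\<close>

lemma measure_unit_squares:
  "real (unit_square_index v) * prob unit_squares = 1 - 1 / real (residue_card v)"
proof -
  let ?C = "square_coset ` val_units v"
  have coset: "C \<in> sets \<mu> \<and> prob C = prob unit_squares" if C: "C \<in> ?C" for C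
  proof -
    obtain u where u: "u \<in> val_units v" "C = square_coset u" using C by blast
    then have "u \<in> val_ring v" "u \<noteq> 0" "v u = 0" by (auto simp: val_units_eq val_ring_def)
    then show ?thesis using u square_coset_in_sets[of u] measure_square_coset[of u] by simp
  qed
  have "\<Union>?C = val_units v"
  proof
    show "\<Union>?C \<subseteq> val_units v"
      by (auto simp: in_square_coset val_units_eq v_mult v_power)
    show "val_units v \<subseteq> \<Union>?C" using center_in_square_coset by blast
  qed
  moreover have "prob (\<Union>C\<in>?C. C) = (\<Sum>C\<in>?C. prob C)"
  proof (rule finite_measure_finite_Union[OF finite_square_cosets])
    show "(\<lambda>C. C) ` ?C \<subseteq> sets \<mu>" using coset by auto
    show "disjoint_family_on (\<lambda>C. C) ?C"
      unfolding disjoint_family_on_def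
    proof (intro ballI impI)
      fix C D assume "C \<in> ?C" "D \<in> ?C" "C \<noteq> D"
      then obtain c d where "C = square_coset c" "D = square_coset d" by blast
      with \<open>C \<noteq> D\<close> show "C \<inter> D = {}" using square_coset_eq by (metis disjoint_iff)
    qed
  qed
  moreover have "(\<Sum>C\<in>?C. prob C) = real (unit_square_index v) * prob unit_squares"
    using coset by (simp add: unit_square_index_eq)
  ultimately show ?thesis using measure_units by simp
qed

lemma
  assumes a: "a \<in> val_ring v" "a \<noteq> 0"
  defines "T \<equiv> {a * y\<^sup>2 | y. y \<in> val_ring v \<and> y \<noteq> 0}"
  shows square_multiples_in_sets: "T \<in> sets \<mu>"
    and measure_square_multiples: "prob T =
      1 / (real (unit_square_index v) * real (residue_card v) powi (v a - 1)
           * (real (residue_card v) + 1))"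
proof -
  define q where "q = real (residue_card v)"
  have q: "q > 1" using residue_card_gt_1 by (simp add: q_def)
  define \<nu> where "\<nu> = real (unit_square_index v)"
  have \<nu>: "\<nu> * prob unit_squares = 1 - 1 / q"
    using measure_unit_squares by (simp add: \<nu>_def q_def)
  then have \<nu>0: "\<nu> \<noteq> 0" using q by auto
  then have prob_U: "prob unit_squares = (1 - 1 / q) / \<nu>" using \<nu> by (simp add: field_simps)
  define k where "k = nat (v a)"
  have k: "v a = int k" using a by (auto simp: k_def val_ring_def)
  obtain p where p: "p \<noteq> 0" "v p = 1" by (rule exists_v_eq)
  define B where "B j = square_coset (a * p ^ (2 * j))" for j
  have vc: "v (a * p ^ (2 * j)) = int (k + 2 * j)" for j
    using a p by (simp add: v_mult v_power k)
  have c: "a * p ^ (2 * j) \<in> val_ring v" "a * p ^ (2 * j) \<noteq> 0" for j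
    using a p vc[of j] by (auto simp: val_ring_def)
  have B_sets: "range B \<subseteq> sets \<mu>"
    using square_coset_in_sets[OF c] by (auto simp: B_def)
  \<comment> \<open>The valuation is constant on each piece and differs between pieces, which gives
    disjointness.\<close>
  have B_val: "v x = int (k + 2 * j)" if "x \<in> B j" for x j
    using that c(2)[of j] vc[of j]
    by (auto simp del: mult_eq_0_iff simp: B_def in_square_coset v_mult v_power val_units_eq)
  have disj: "disjoint_family B"
    unfolding disjoint_family_on_def
  proof (intro ballI impI)
    fix i j :: nat assume "i \<noteq> j"
    then show "B i \<inter> B j = {}" using B_val[of _ i] B_val[of _ j] by fastforce
  qed
  have T_eq: "T = (\<Union>j. B j)"
  proof (intro set_eqI iffI)
    fix x assume "x \<in> T"
    then obtain y where y: "x = a * y\<^sup>2" "y \<noteq> 0" "y \<in> val_ring v" by (auto simp: T_def)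
    \<comment> \<open>The index of the piece is the valuation of \<open>y\<close>; dividing by
      \<open>p ^ j\<close> leaves a unit.\<close>
    define j where "j = nat (v y)"
    have "v y = int j" using y by (auto simp: j_def val_ring_def)
    then have "y / p ^ j \<in> val_units v" using y p by (simp add: val_units_eq v_divide v_power)
    moreover have "x = a * p ^ (2 * j) * (y / p ^ j)\<^sup>2"
      using y p by (simp add: power_divide power_mult[symmetric] mult.commute)
    ultimately have "x \<in> B j" by (auto simp: B_def in_square_coset)
    then show "x \<in> (\<Union>j. B j)" by blast
  next
    fix x assume "x \<in> (\<Union>j. B j)"
    then obtain j w where w: "w \<in> val_units v" "x = a * p ^ (2 * j) * w\<^sup>2"
      by (auto simp: B_def in_square_coset)
    then have "x = a * (p ^ j * w)\<^sup>2"
      by (simp add: power_mult_distrib power_mult[symmetric] mult.commute mult.left_commute)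
    moreover have "p ^ j * w \<in> val_ring v" "p ^ j * w \<noteq> 0"
      using w p by (auto simp: val_units_eq val_ring_def v_mult v_power)
    ultimately show "x \<in> T" by (auto simp: T_def)
  qed
  show "T \<in> sets \<mu>" unfolding T_eq using B_sets by (intro sets.countable_UN) auto
  have "(\<lambda>j. prob (B j)) sums prob T"
    unfolding T_eq by (rule finite_measure_UNION[OF B_sets disj])
  moreover have "prob (B j) = prob unit_squares / q ^ k * (1 / q\<^sup>2) ^ j" for j
    using measure_square_coset[OF c, of j] unfolding vc nat_int B_def q_def
    by (simp add: power_add power_mult power_one_over)
  moreover have "(\<lambda>j. prob unit_squares / q ^ k * (1 / q\<^sup>2) ^ j) sums
      (prob unit_squares / q ^ k * (1 / (1 - 1 / q\<^sup>2)))"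
    using q by (intro sums_mult geometric_sums) (simp add: power_strict_mono)
  ultimately have "prob T = prob unit_squares / q ^ k * (1 / (1 - 1 / q\<^sup>2))"
    using sums_unique2 by simp
  \<comment> \<open>The factor \<open>1 - 1 / q\<close> from the measure of the units cancels
    against the sum of the geometric series.\<close>
  also have "\<dots> = (1 - 1 / q) / \<nu> / q ^ k * (1 / ((1 - 1 / q) * (1 + 1 / q)))"
    by (simp add: prob_U power2_eq_square algebra_simps)
  also have "\<dots> = 1 / (\<nu> * q ^ k * (1 + 1 / q))"
    using q by simp
  \<comment> \<open>Clearing the denominator of \<open>1 + 1 / q\<close> lowers the exponent by one.
    It is -1 when \<open>v a = 0\<close>, hence the integer power \<open>powi\<close>.\<close>
  also have "\<dots> = 1 / (\<nu> * (q ^ k / q) * (q + 1))"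
    using q by (simp add: field_simps)
  also have "q ^ k / q = q powi (v a - 1)"
    using q by (simp add: k power_int_diff)
  finally show "prob T = 1 / (real (unit_square_index v) * real (residue_card v) powi (v a - 1)
           * (real (residue_card v) + 1))"
    by (simp add: \<nu>_def q_def)
qed

section \<open>Represented elements in one square class\<close>

lemma
  fixes f :: "'a ^ 'n \<Rightarrow> 'a" and s :: 'a
  assumes f: "quadratic_form_over v f"
  defines "D \<equiv> represented v f \<inter> square_class s"
  shows represented_class_in_sets: "D \<in> sets \<mu>"
    and measure_represented_class: "prob D = (case min_val v f s of
        enat k \<Rightarrow> 1 / (real (unit_square_index v) * real (residue_card v) powi (int k - 1)
                        * (real (residue_card v) + 1))
      | \<infinity> \<Rightarrow> 0)"
proof -
  obtain A where A: "\<And>i j. A $ i $ j \<in> val_ring v"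
    "\<And>x. f x = (\<Sum>i\<in>UNIV. \<Sum>j\<in>UNIV. A $ i $ j * x $ i * x $ j)"
    using f by (auto simp: quadratic_form_over_def)
  have integral: "z \<in> val_ring v" if "z \<in> represented v f" for z
    using that A by (auto simp: represented_def intro!: val_ring_sum val_ring_mult)
  \<comment> \<open>Homogeneity: scaling an integral vector by \<open>y\<close> multiplies the value
    of the form by the square of \<open>y\<close>.\<close>
  have closed: "z * y\<^sup>2 \<in> represented v f" if z: "z \<in> represented v f" and
    y: "y \<in> val_ring v" "y \<noteq> 0" for z y
  proof -
    obtain x where x: "\<And>i. x $ i \<in> val_ring v" "z = f x" "z \<noteq> 0"
      using z by (auto simp: represented_def)
    have "f (\<chi> i. y * x $ i) = z * y\<^sup>2"
      by (simp add: A x(2) sum_distrib_left sum_distrib_right power2_eq_square mult_ac)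
    moreover have "(\<chi> i. y * x $ i) \<in> {x. \<forall>i. x $ i \<in> val_ring v}"
      using x y by (auto intro: val_ring_mult)
    ultimately have "z * y\<^sup>2 \<in> f ` {x. \<forall>i. x $ i \<in> val_ring v}" by (metis image_eqI)
    then show ?thesis using x(3) y(2) by (simp add: represented_def)
  qed
  have "D \<in> sets \<mu> \<and> prob D = (case min_val v f s of
        enat k \<Rightarrow> 1 / (real (unit_square_index v) * real (residue_card v) powi (int k - 1)
                        * (real (residue_card v) + 1))
      | \<infinity> \<Rightarrow> 0)"
  proof (cases "D = {}")
    case True
    \<comment> \<open>The infimum over the empty set is infinity, which selects the zero
      branch.\<close>
    then show ?thesis by (simp add: min_val_def D_def[symmetric] top_enat_def)
  next
    case False
    \<comment> \<open>A nonempty set in the well-ordered type \<open>enat\<close> attains its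
      infimum.\<close>
    have "min_val v f s \<in> (\<lambda>x. enat (nat (v x))) ` D"
      using False LeastI_ex[of "\<lambda>y. y \<in> (\<lambda>x. enat (nat (v x))) ` D"]
      by (auto simp: min_val_def D_def[symmetric] Inf_enat_def)
    then obtain a where a: "a \<in> D" "min_val v f s = enat (nat (v a))" by blast
    have min: "nat (v a) \<le> nat (v x)" if "x \<in> D" for x
    proof -
      have "min_val v f s \<le> enat (nat (v x))"
        unfolding min_val_def D_def[symmetric] using that by (rule INF_lower)
      then show ?thesis by (simp add: a(2))
    qed
    have D_integral: "x \<in> val_ring v \<and> x \<noteq> 0" if "x \<in> D" for x
      using that integral[of x] by (simp add: D_def represented_def)
    then have aR: "a \<in> val_ring v" "a \<noteq> 0" using a(1) by auto
    then have va: "0 \<le> v a" by (simp add: val_ring_def)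
    have "a \<in> square_class s" using a(1) by (simp add: D_def)
    then have D_eq: "D = represented v f \<inter> square_class a"
      unfolding D_def by (simp only: square_class_eq)
    have "D = {a * y\<^sup>2 | y. y \<in> val_ring v \<and> y \<noteq> 0}"
    proof (intro set_eqI iffI)
      fix x assume x: "x \<in> D"
      then obtain y where y: "y \<noteq> 0" "x = a * y\<^sup>2"
        unfolding D_eq by (auto simp: square_class_def)
      have "0 \<le> v x" using D_integral[OF x] by (auto simp: val_ring_def)
      then have "v a \<le> v x" using min[OF x] va by simp
      then have "y \<in> val_ring v" using y aR by (simp add: v_mult v_power val_ring_def)
      then show "x \<in> {a * y\<^sup>2 | y. y \<in> val_ring v \<and> y \<noteq> 0}" using y by blast
    next
      fix x assume "x \<in> {a * y\<^sup>2 | y. y \<in> val_ring v \<and> y \<noteq> 0}"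
      then obtain y where y: "y \<in> val_ring v" "y \<noteq> 0" "x = a * y\<^sup>2" by blast
      moreover have "a \<in> represented v f" using a(1) by (simp add: D_def)
      ultimately show "x \<in> D"
        unfolding D_eq using closed[of a y] by (auto simp: square_class_def)
    qed
    then show ?thesis
      using square_multiples_in_sets[OF aR] measure_square_multiples[OF aR] va by (simp add: a(2))
  qed
  then show "D \<in> sets \<mu>" "prob D = (case min_val v f s of
        enat k \<Rightarrow> 1 / (real (unit_square_index v) * real (residue_card v) powi (int k - 1)
                        * (real (residue_card v) + 1))
      | \<infinity> \<Rightarrow> 0)" by blast+
qed

end

section \<open>Summation over the square classes\<close>

theorem theorem2p2:
  fixes v :: "'a::field \<Rightarrow> int"
    and S :: "'a set"
    and \<mu> :: "'a measure"
    and f :: "'a ^ 'n \<Rightarrow> 'a"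
  assumes "local_field v"
    and "square_class_reps S"
    and "haar_measure v \<mu>"
    and "quadratic_form_over v f"
    and "nondegenerate_form f"
  shows "form_density v \<mu> f =
    (\<Sum>s\<in>S. case min_val v f s of
        enat k \<Rightarrow> 1 / (real (unit_square_index v) * real (residue_card v) powi (int k - 1)
                        * (real (residue_card v) + 1))
      | \<infinity> \<Rightarrow> 0)"
proof -
  interpret haar_local_field v \<mu>
    using assms by (intro haar_local_field.intro haar_local_field_axioms.intro)
  define D where "D s = represented v f \<inter> square_class s" for s
  have "represented v f = (\<Union>s\<in>S. D s)"
  proof
    show "represented v f \<subseteq> (\<Union>s\<in>S. D s)"
    proof
      fix x assume "x \<in> represented v f"
      moreover from this have "x \<noteq> 0" by (simp add: represented_def)
      then obtain s where "s \<in> S" "x \<in> square_class s"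
        using assms(2) unfolding square_class_reps_def by blast
      ultimately show "x \<in> (\<Union>s\<in>S. D s)" by (auto simp: D_def)
    qed
  qed (auto simp: D_def)
  moreover have "prob (\<Union>s\<in>S. D s) = (\<Sum>s\<in>S. prob (D s))"
  proof (rule finite_measure_finite_Union[OF finite_square_class_reps[OF assms(2)]])
    show "D ` S \<subseteq> sets \<mu>"
      using represented_class_in_sets[OF assms(4)] by (auto simp: D_def)
    show "disjoint_family_on D S"
      unfolding disjoint_family_on_def
    proof (intro ballI impI equals0I)
      fix s t x assume st: "s \<in> S" "t \<in> S" "s \<noteq> t" and x: "x \<in> D s \<inter> D t"
      then have "x \<noteq> 0" "x \<in> square_class s" "x \<in> square_class t"
        by (auto simp: D_def represented_def)
      then show False using assms(2) st unfolding square_class_reps_def by blast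
    qed
  qed
  ultimately show ?thesis
    using measure_represented_class[OF assms(4)]
    by (simp add: form_density_def D_def)
qed

end
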